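(* Let $d\ge 3$ and $1\le a<b\le d-1$ be integers with $\gcd(a,b,d)=1$. Let $M=\mathrm{Circ}_{(d;0,a,b)}$ be the $d\times d$ three-lines circulant matrix with entries in $\mathbb{Z}[x,y,z]$. Then for all nonnegative integers $A,B$ with $A+B\le d$, the coefficient of $x^{d-A-B}y^Az^B$ in $\det(M)$ equals, up to sign, the coefficient of $x^{d-A-B}y^Az^B$ in the permanent of $M$: $$[\det(M)]_{d-A-B,A,B}=\pm[\operatorname{per}(M)]_{d-A-B,A,B}.$$ In particular, the number $D_{(d;0,a,b)}$ of distinct monomials appearing with non-zero coefficient in $\det(M)$ equals the number $P_{(d;0,a,b)}$ of distinct monomials appearing with non-zero coefficient in $\operatorname{per}(M)$.
   Context: For integers $d\ge 3$ and $1\le a<b\le d-1$, $\mathrm{Circ}_{(d;0,a,b)}$ is the $d\times d$ matrix with rows and columns indexed by $0,\dots,d-1$ whose $(i,j)$ entry is $x$ if $j-i\equiv 0 \pmod d$, $y$ if $j-i\equiv a\pmod d$, $z$ if $j-i\equiv b\pmod d$, and $0$ otherwise, where $x,y,z$ are indeterminates. For a polynomial $F\in\mathbb{Z}[x,y,z]$, $[F]_{i,j,k}$ denotes the coefficient of $x^iy^jz^k$ in $F$. The permanent of a $d\times d$ matrix $(m_{i,j})$ is $\sum_{\sigma\in S_d}\prod_i m_{i,\sigma(i)}$. *)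

theory Defs
  imports "HOL-Library.Poly_Mapping" "HOL-Number_Theory.Cong" "Jordan_Normal_Form.Determinant"
begin

datatype indet = X | Y | Z

text \<open>The polynomial ring in the three indeterminates over the integers, as finitely supported
  functions from exponent vectors to integer coefficients. Its multiplication is the convolution
  product of \<^theory>\<open>HOL-Library.Poly_Mapping\<close>.\<close>

type_synonym poly_xyz = "(indet \<Rightarrow>\<^sub>0 nat) \<Rightarrow>\<^sub>0 int"

definition var :: "indet \<Rightarrow> poly_xyz" where
  "var v = Poly_Mapping.single (Poly_Mapping.single v 1) 1"

definition expo :: "nat \<Rightarrow> nat \<Rightarrow> nat \<Rightarrow> (indet \<Rightarrow>\<^sub>0 nat)" where
  "expo i j k = Poly_Mapping.single X i + Poly_Mapping.single Y j + Poly_Mapping.single Z k"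

definition coeff_xyz :: "poly_xyz \<Rightarrow> nat \<Rightarrow> nat \<Rightarrow> nat \<Rightarrow> int" where
  "coeff_xyz F i j k = Poly_Mapping.lookup F (expo i j k)"

definition num_monomials :: "poly_xyz \<Rightarrow> nat" where
  "num_monomials F = card (Poly_Mapping.keys F)"

text \<open>As for \<^const>\<open>det\<close>, the value on non-square matrices is the dummy \<open>0\<close>.\<close>

definition permanent :: "'a::comm_ring_1 mat \<Rightarrow> 'a" where
  "permanent A = (if dim_row A = dim_col A
     then (\<Sum>p \<in> {p. p permutes {0..<dim_row A}}. \<Prod>i = 0..<dim_row A. A $$ (i, p i))
     else 0)"

definition circ :: "nat \<Rightarrow> nat \<Rightarrow> nat \<Rightarrow> poly_xyz mat" where
  "circ d a b = mat d d (\<lambda>(i, j).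
     if [int j - int i = 0] (mod int d) then var X
     else if [int j - int i = int a] (mod int d) then var Y
     else if [int j - int i = int b] (mod int d) then var Z
     else 0)"

end

theory Submission
  imports Defs
begin

text \<open>Both coefficients of a monomial are sums over the permutations \<open>p\<close> of \<open>\<int>/d\<close> that make
  prescribed numbers of steps \<open>0\<close>, \<open>a\<close> and \<open>b\<close>, so it suffices that all these permutations have the
  same sign. Let \<open>q\<close> be \<open>p\<close> followed by the rotation by \<open>-b\<close>. It fixes the points where \<open>p\<close> steps by
  \<open>b\<close>; on the set \<open>N\<close> of the other points it steps by \<open>-b\<close> or \<open>-b + a\<close>, hence permutes the cosets of
  the subgroup \<open>\<langle>a\<rangle>\<close> cyclically, by \<open>gcd(a, b, d) = 1\<close>. With \<open>g = gcd(a, d)\<close>, the iterate \<open>q\<^sup>g\<close> maps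
  the points of \<open>N\<close> in \<open>\<langle>a\<rangle>\<close> to themselves and preserves their cyclic order, so it rotates them by some
  number \<open>W\<close> of places. Summing the displacements expresses \<open>W\<close> through the numbers of steps. As \<open>q\<close> on
  \<open>N\<close> is conjugate to a model depending only on \<open>g\<close>, \<open>W\<close> and the cardinality of \<open>N\<close>, its sign is
  determined, and with it the sign of \<open>p\<close>.\<close>

section \<open>Periodic sets of integers\<close>

lemma periodic_set_mult:
  fixes S :: "int set"
  assumes per: "\<And>x. x + n \<in> S \<longleftrightarrow> x \<in> S"
  shows "x + n * k \<in> S \<longleftrightarrow> x \<in> S"
proof (induction k rule: int_induct[where k = 0])
  case (step1 i)
  then show ?case using per[of "x + n * i"] by (simp add: algebra_simps)
next
  case (step2 i)
  then show ?case using per[of "x + n * (i - 1)"] by (simp add: algebra_simps)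
qed simp

text \<open>Replaces a periodic set by its line of indices, on which an order-preserving bijection
  can be recognised as a translation.\<close>

lemma periodic_enumeration:
  fixes S :: "int set"
  assumes n: "n > 0" and per: "\<And>x. x + n \<in> S \<longleftrightarrow> x \<in> S" and ne: "S \<noteq> {}"
  defines "m \<equiv> int (card (S \<inter> {0..<n}))"
  obtains e :: "int \<Rightarrow> int" where "strict_mono e" "range e = S" "m > 0"
    "\<And>l k. e (l + m * k) = e l + n * k" "bij_betw e {0..<m} (S \<inter> {0..<n})"
proof -
  define U where "U = S \<inter> {0..<n}"
  define xs where "xs = sorted_list_of_set U"
  have perk: "x + n * k \<in> S \<longleftrightarrow> x \<in> S" for x k
    using periodic_set_mult per by blast
  have fin: "finite U" unfolding U_def by auto
  have setxs: "set xs = U" and len: "int (length xs) = m" and sorted: "sorted_wrt (<) xs"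
    using fin unfolding xs_def m_def U_def by auto
  obtain s where s: "s \<in> S" using ne by auto
  have "s mod n \<in> U"
    using perk[of s "- (s div n)"] s n unfolding U_def
    by (auto simp: minus_mult_div_eq_mod)
  then have m: "m > 0"
    using fin unfolding m_def U_def by (metis card_gt_0_iff empty_iff of_nat_0_less_iff)
  \<comment> \<open>The quotient \<open>l div m\<close> selects the period, the remainder the place
    in the sorted list of representatives.\<close>
  define e where "e l = xs ! nat (l mod m) + n * (l div m)" for l
  have idx: "nat (l mod m) < length xs" for l
    using m len by (metis nat_less_iff pos_mod_bound pos_mod_sign)
  have inU: "xs ! nat (l mod m) \<in> U" for l
    using idx setxs nth_mem by blast
  have shift: "e (l + m * k) = e l + n * k" for l k
    using m unfolding e_def by (simp add: algebra_simps)
  have mono: "e l < e l'" if "l < l'" for l l'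
  proof (cases "l div m = l' div m")
    case True
    then have "l mod m < l' mod m"
      using that by (metis add_less_cancel_left mult_div_mod_eq)
    then have "nat (l mod m) < nat (l' mod m)"
      using m by (simp add: nat_mono_iff order_le_less_trans[OF pos_mod_sign])
    then have "xs ! nat (l mod m) < xs ! nat (l' mod m)"
      using sorted idx by (simp add: sorted_wrt_nth_less)
    then show ?thesis unfolding e_def using True by simp
  next
    case False
    \<comment> \<open>Different periods are at least \<open>n\<close> apart, more than two
      representatives in \<open>{0..<n}\<close> can differ.\<close>
    have "l div m \<le> l' div m"
      using that m by (simp add: zdiv_mono1)
    with False have "n * (l div m + 1) \<le> n * (l' div m)"
      using n by simp
    moreover have "xs ! nat (l mod m) < n" "0 \<le> xs ! nat (l' mod m)"
      using inU[of l] inU[of l'] unfolding U_def by auto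
    ultimately show ?thesis unfolding e_def by (simp add: algebra_simps)
  qed
  then have sm: "strict_mono e" by (rule strict_monoI)
  have e_base: "e ` {0..<m} = U"
  proof -
    have "e l = xs ! nat l" if "l \<in> {0..<m}" for l
      using that unfolding e_def by simp
    then have "e ` {0..<m} = (\<lambda>l. xs ! nat l) ` {0..<m}" by (rule image_cong[OF refl])
    also have "\<dots> = (!) xs ` (nat ` {0..<m})" by (simp add: image_image)
    also have "nat ` {0..<m} = {0..<length xs}"
      by (simp add: len[symmetric] image_int_atLeastLessThan[of 0, simplified, symmetric] image_image)
    also have "(!) xs ` {0..<length xs} = set xs"
      by (auto simp: set_conv_nth)
    finally show ?thesis using setxs by simp
  qed
  have "range e = S"
  proof (intro equalityI subsetI)
    fix x assume "x \<in> range e"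
    then show "x \<in> S" using inU perk unfolding e_def U_def by auto
  next
    fix x assume x: "x \<in> S"
    have "x mod n \<in> U"
      using perk[of x "- (x div n)"] x n unfolding U_def
      by (auto simp: minus_mult_div_eq_mod)
    then obtain l where "e l = x mod n" using e_base by (metis imageE)
    then have "e (l + m * (x div n)) = x" using shift by simp
    then show "x \<in> range e" by (metis rangeI)
  qed
  moreover have "bij_betw e {0..<m} U"
    using e_base strict_mono_imp_inj_on[OF sm] unfolding bij_betw_def
    by (auto intro: inj_on_subset)
  ultimately show ?thesis
    using that[of e] sm m shift unfolding U_def by blast
qed

text \<open>The value \<open>s l + 1\<close> is attained, and monotonicity allows it only at
  \<open>l + 1\<close>.\<close>

lemma strict_mono_surj_int:
  fixes s :: "int \<Rightarrow> int"
  assumes mono: "strict_mono s" and surj: "surj s"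
  shows "s l = s 0 + l"
proof -
  have step: "s (l + 1) = s l + 1" for l
  proof -
    obtain k where k: "s k = s l + 1" using surj by (metis surjD)
    then have "l < k" using strict_mono_less[OF mono] by (metis zless_add1_eq)
    have "s (l + 1) \<le> s k"
      using \<open>l < k\<close> strict_mono_less_eq[OF mono] by simp
    moreover have "s l < s (l + 1)" using strict_mono_less[OF mono] by simp
    ultimately show ?thesis using k by simp
  qed
  show ?thesis
  proof (induction l rule: int_induct[where k = 0])
    case (step2 i)
    then show ?case using step[of "i - 1"] by simp
  qed (use step in auto)
qed

text \<open>Moving the window of summation by one place replaces \<open>e W\<close> by
  \<open>e (W + m)\<close>, a gain of \<open>n\<close>.\<close>

lemma sum_shift_quasiperiodic:
  fixes e :: "int \<Rightarrow> int"
  assumes m: "m > 0" and e: "\<And>l. e (l + m) = e l + n"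
  shows "(\<Sum>l\<in>{0..<m}. e (l + W)) = (\<Sum>l\<in>{0..<m}. e l) + n * W"
proof -
  have step: "(\<Sum>l\<in>{0..<m}. e (l + (W + 1))) = (\<Sum>l\<in>{0..<m}. e (l + W)) + n" for W
  proof -
    have "(\<Sum>l\<in>{0..<m}. e (l + (W + 1))) = (\<Sum>l\<in>{1..<m+1}. e (l + W))"
      by (rule sum.reindex_bij_witness[of _ "\<lambda>l. l - 1" "\<lambda>l. l + 1"])
        (auto simp: algebra_simps)
    also have "{1..<m+1} = insert m {1..<m}" using m by auto
    also have "(\<Sum>l\<in>\<dots>. e (l + W)) = (\<Sum>l\<in>{1..<m}. e (l + W)) + e W + n"
      using e[of W] by (simp add: add.commute)
    also have "(\<Sum>l\<in>{1..<m}. e (l + W)) + e W = (\<Sum>l\<in>insert 0 {1..<m}. e (l + W))"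
      by simp
    also have "insert 0 {1..<m} = {0..<m}" using m by auto
    finally show ?thesis .
  qed
  show ?thesis
  proof (induction W rule: int_induct[where k = 0])
    case (step1 i)
    then show ?case using step[of i] by (simp add: algebra_simps)
  next
    case (step2 i)
    then show ?case using step[of "i - 1"] by (simp add: algebra_simps)
  qed simp
qed

section \<open>Permutations advancing along the cosets of a cyclic subgroup\<close>

text \<open>In \<^term>\<open>(j, l)\<close>, \<^term>\<open>j\<close> numbers the cosets of the subgroup generated by \<open>a\<close>, traversed in
  steps of \<open>c\<close>, and \<^term>\<open>l\<close> numbers the points on a coset in cyclic order.\<close>

definition skew_shift :: "nat \<Rightarrow> int \<Rightarrow> int \<Rightarrow> nat \<times> int \<Rightarrow> nat \<times> int" where
  "skew_shift g m W = (\<lambda>(j, l). if Suc j < g then (Suc j, l) else (0, (l + W) mod m))"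

text \<open>In the application \<open>c\<close> is \<open>d - b\<close> and \<open>\<delta>\<close>
  marks the steps by \<open>a\<close>. Coprimality makes \<open>c\<close> a generator of the
  integers modulo \<open>d\<close> divided by the subgroup of \<open>a\<close>.\<close>

locale drifting_permutation =
  fixes d a c :: int and N :: "int set" and q \<delta> :: "int \<Rightarrow> int"
  assumes d_pos: "0 < d"
    and coprime: "gcd a (gcd c d) = 1"
    and N_sub: "N \<subseteq> {0..<d}"
    and q_permutes: "q permutes N"
    and q_step: "x \<in> N \<Longrightarrow> q x = (x + c + \<delta> x * a) mod d"
    and \<delta>_cases: "x \<in> N \<Longrightarrow> \<delta> x = 0 \<or> \<delta> x = 1"
begin

abbreviation "g \<equiv> gcd a d"
abbreviation "n \<equiv> d div g"

text \<open>Since \<open>g\<close> is a Bezout combination of \<open>a\<close> and \<open>d\<close>,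
  the displacement \<open>g * c\<close> is a multiple of \<open>a\<close> modulo \<open>d\<close>;
  \<open>rho\<close> is its multiplier and depends on \<open>a\<close>, \<open>c\<close>,
  \<open>d\<close> alone.\<close>

definition "rho = fst (bezout_coefficients a d) * c"

definition D :: "nat \<Rightarrow> int \<Rightarrow> int" where
  "D j x = (\<Sum>i<j. \<delta> ((q ^^ i) x))"

text \<open>The trace of \<^term>\<open>N\<close> on the subgroup generated by \<^term>\<open>a\<close>, unrolled to a periodic set of
  integers. On it, \<open>G\<close> below lifts the return map \<^term>\<open>q ^^ nat g\<close>.\<close>

definition S :: "int set" where
  "S = {u. (u * a) mod d \<in> N}"

definition G :: "int \<Rightarrow> int" where
  "G u = u + rho + D (nat g) ((u * a) mod d)"

section \<open>Arithmetic of the subgroup generated by \<open>a\<close>\<close>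

lemma g_pos: "g > 0"
  using d_pos by (simp add: gcd_pos_int)

lemma n_g: "n * g = d"
  by simp

lemma n_pos: "n > 0"
  using d_pos g_pos n_g by (metis zero_less_mult_pos2)

text \<open>The order of \<open>a\<close> modulo \<open>d\<close> is \<open>n\<close>: after
  division by \<open>g\<close>, the factor \<open>a div g\<close> is coprime to \<open>n\<close> and
  cancels.\<close>

lemma mult_a_cong_iff: "(u * a) mod d = (u' * a) mod d \<longleftrightarrow> u mod n = u' mod n"
proof -
  have cop: "Rings.coprime n (a div g)"
    using d_pos by (metis coprime_commute div_gcd_coprime less_irrefl)
  have "(u - u') * (a div g) * g = u * a - u' * a"
    by (simp only: mult.assoc dvd_div_mult_self[OF gcd_dvd1] left_diff_distrib)
  then have "(u * a) mod d = (u' * a) mod d \<longleftrightarrow> n * g dvd (u - u') * (a div g) * g"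
    unfolding mod_eq_dvd_iff by simp
  also have "\<dots> \<longleftrightarrow> n dvd (u - u') * (a div g)"
    using g_pos by (simp only: dvd_mult_cancel_right) auto
  also have "\<dots> \<longleftrightarrow> n dvd u - u'"
    using cop by (simp add: coprime_dvd_mult_left_iff)
  finally show ?thesis by (simp add: mod_eq_dvd_iff)
qed

lemma bezout: "\<exists>s t. g = s * a + t * d \<and> rho = s * c"
  unfolding rho_def by (metis bezout_coefficients_fst_snd)

lemma g_c_cong: "(g * c) mod d = (rho * a) mod d"
proof -
  obtain s t where st: "g = s * a + t * d" "rho = s * c" using bezout by auto
  have "g * c = rho * a + d * (t * c)"
    unfolding st(2) by (subst st(1)) (simp add: algebra_simps)
  then show ?thesis by simp
qed

lemma multiple_of_g:
  assumes "x \<in> {0..<d}" and "g dvd x"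
  obtains u where "u \<in> {0..<n}" "x = (u * a) mod d"
proof -
  obtain y where y: "x = g * y" using assms(2) by auto
  obtain s t where st: "g = s * a + t * d" using bezout by auto
  have "x = (y * s) * a + d * (t * y)"
    unfolding y by (subst st(1)) (simp add: algebra_simps)
  then have "x mod d = ((y * s) * a) mod d" by simp
  also have "\<dots> = (((y * s) mod n) * a) mod d"
    by (subst mult_a_cong_iff) simp
  finally have "x = (((y * s) mod n) * a) mod d" using assms(1) by simp
  moreover have "(y * s) mod n \<in> {0..<n}" using n_pos by simp
  ultimately show ?thesis using that by blast
qed

section \<open>Iterates of \<open>q\<close> and the return map to the subgroup\<close>

lemma funpow_permutes: "(q ^^ j) permutes N"
proof (induction j)
  case (Suc j)
  then show ?case using permutes_compose[OF Suc q_permutes] by (simp add: o_def)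
qed (simp add: permutes_def)

lemma funpow_in: "x \<in> N \<Longrightarrow> (q ^^ j) x \<in> N"
  using permutes_in_image[OF funpow_permutes] by simp

lemma funpow_inj: "(q ^^ j) x = (q ^^ j) y \<longleftrightarrow> x = y"
  using permutes_inj[OF funpow_permutes] by (simp add: inj_eq)

lemma finite_N: "finite N"
  using N_sub finite_subset by auto

lemma funpow_step: "x \<in> N \<Longrightarrow> (q ^^ j) x = (x + int j * c + D j x * a) mod d"
proof (induction j)
  case 0
  then show ?case using N_sub by (auto simp: D_def)
next
  case (Suc j)
  have "(q ^^ Suc j) x = ((q ^^ j) x + c + \<delta> ((q ^^ j) x) * a) mod d"
    using q_step[OF funpow_in[OF Suc.prems]] by simp
  also have "\<dots> = (x + int j * c + D j x * a + (c + \<delta> ((q ^^ j) x) * a)) mod d"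
    by (subst (1) Suc.IH[OF Suc.prems]) (simp add: mod_add_left_eq add.assoc)
  also have "\<dots> = (x + int (Suc j) * c + D (Suc j) x * a) mod d"
    by (simp add: D_def algebra_simps)
  finally show ?case .
qed

lemma S_periodic: "u + n \<in> S \<longleftrightarrow> u \<in> S"
proof -
  have "((u + n) * a) mod d = (u * a) mod d"
    by (subst mult_a_cong_iff) simp
  then show ?thesis unfolding S_def by simp
qed

text \<open>Each step moves a point by \<open>0\<close> or \<open>1\<close> within its coset, so two points could only pass each
  other by first colliding, which injectivity forbids.\<close>

lemma drift_mono:
  assumes "u \<in> S" "u' \<in> S" "u < u'"
  shows "u + D j ((u * a) mod d) < u' + D j ((u' * a) mod d)"
proof (induction j)
  case 0
  then show ?case using assms by (simp add: D_def)
next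
  case (Suc j)
  define x where "x = (u * a) mod d"
  define x' where "x' = (u' * a) mod d"
  have N: "x \<in> N" "x' \<in> N" using assms unfolding S_def x_def x'_def by auto
  have le: "u + D (Suc j) x \<le> u' + D (Suc j) x'"
    using Suc \<delta>_cases[OF funpow_in[OF N(1), of j]] \<delta>_cases[OF funpow_in[OF N(2), of j]]
    by (auto simp: D_def x_def x'_def)
  have "u + D (Suc j) x \<noteq> u' + D (Suc j) x'"
  proof
    assume eq: "u + D (Suc j) x = u' + D (Suc j) x'"
    have pow: "(q ^^ Suc j) ((v * a) mod d) = ((v + D (Suc j) ((v * a) mod d)) * a + int (Suc j) * c) mod d"
      if "(v * a) mod d \<in> N" for v
    proof -
      have "(q ^^ Suc j) ((v * a) mod d)
          = ((v * a) mod d + (int (Suc j) * c + D (Suc j) ((v * a) mod d) * a)) mod d"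
        using funpow_step[OF that, of "Suc j"] by (simp only: add.assoc)
      also have "\<dots> = (v * a + (int (Suc j) * c + D (Suc j) ((v * a) mod d) * a)) mod d"
        by (rule mod_add_left_eq)
      finally show ?thesis by (simp only: algebra_simps)
    qed
    have "(q ^^ Suc j) x = (q ^^ Suc j) x'"
      using pow[of u] pow[of u'] N eq unfolding x_def x'_def by simp
    then have "x = x'" using funpow_inj by blast
    with eq assms(3) show False by simp
  qed
  with le show ?case unfolding x_def x'_def by simp
qed

lemma G_mono: "u \<in> S \<Longrightarrow> u' \<in> S \<Longrightarrow> u < u' \<Longrightarrow> G u < G u'"
  using drift_mono[of u u' "nat g"] unfolding G_def by simp

text \<open>The total contribution \<open>g * c\<close> of the \<open>c\<close>-steps is congruent
  to \<open>rho * a\<close>, so the point is back in the subgroup and only its multiplier of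
  \<open>a\<close> has changed.\<close>

lemma return_map:
  assumes "u \<in> S"
  shows "(q ^^ nat g) ((u * a) mod d) = (G u * a) mod d"
proof -
  let ?x = "(u * a) mod d"
  have "(q ^^ nat g) ?x = (?x + (g * c + D (nat g) ?x * a)) mod d"
    using assms funpow_step[of ?x "nat g"] g_pos unfolding S_def by (simp add: add.assoc)
  also have "\<dots> = (u * a + (g * c + D (nat g) ?x * a)) mod d"
    by (rule mod_add_left_eq)
  also have "\<dots> = (g * c + (u * a + D (nat g) ?x * a)) mod d"
    by (simp only: ac_simps)
  also have "\<dots> = ((g * c) mod d + (u * a + D (nat g) ?x * a)) mod d"
    by (simp only: mod_add_left_eq)
  also have "\<dots> = ((rho * a) + (u * a + D (nat g) ?x * a)) mod d"
    by (simp only: g_c_cong mod_add_left_eq)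
  finally show ?thesis by (simp add: G_def algebra_simps)
qed

lemma G_in_S: "u \<in> S \<Longrightarrow> G u \<in> S"
  using return_map[of u] funpow_in[of "(u * a) mod d" "nat g"] unfolding S_def by simp

lemma G_periodic: "G (u + n * k) = G u + n * k"
proof -
  have "((u + n * k) * a) mod d = (u * a) mod d"
    by (subst mult_a_cong_iff) simp
  then show ?thesis unfolding G_def by simp
qed

text \<open>The extra steps by \<open>a\<close> vanish modulo \<open>g\<close>, so \<open>q\<close>
  moves all cosets rigidly by \<open>c\<close>.\<close>

lemma funpow_mod_g: "x \<in> N \<Longrightarrow> g dvd (q ^^ j) x - x - int j * c"
proof -
  assume "x \<in> N"
  then have "(q ^^ j) x = (x + int j * c + D j x * a) mod d" by (rule funpow_step)
  then have "d dvd (q ^^ j) x - (x + int j * c + D j x * a)"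
    by (metis mod_eq_dvd_iff mod_mod_trivial)
  then have "g dvd (q ^^ j) x - (x + int j * c + D j x * a)"
    using dvd_trans gcd_dvd2 by blast
  moreover have "g dvd D j x * a" by simp
  ultimately have "g dvd ((q ^^ j) x - (x + int j * c + D j x * a)) + D j x * a"
    by (rule dvd_add)
  then show ?thesis by (simp add: algebra_simps)
qed

lemma coprime_g_c: "Rings.coprime g c"
  using coprime by (metis coprime_iff_gcd_eq_1 gcd.assoc gcd.commute)

lemma G_surj:
  assumes t: "t \<in> S"
  obtains u where "u \<in> S" "G u = t"
proof -
  have "(t * a) mod d \<in> N" using t unfolding S_def by simp
  then obtain y where y: "y \<in> N" "(q ^^ nat g) y = (t * a) mod d"
    using permutes_image[OF funpow_permutes[of "nat g"]] by (metis imageE)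
  \<comment> \<open>The preimage \<open>y\<close> again lies in the subgroup, because
    \<open>g\<close> steps of \<open>c\<close> are trivial modulo \<open>g\<close>.\<close>
  have "g dvd (t * a) mod d - y - g * c"
    using funpow_mod_g[OF y(1), of "nat g"] y(2) g_pos by simp
  moreover have "g dvd (t * a) mod d"
    by (simp add: dvd_mod)
  moreover have "y = (t * a) mod d - ((t * a) mod d - y - g * c) - g * c" by simp
  ultimately have "g dvd y" by (metis dvd_diff dvd_triv_left)
  moreover have "y \<in> {0..<d}" using y N_sub by auto
  ultimately obtain u where u: "y = (u * a) mod d" using multiple_of_g by metis
  then have uS: "u \<in> S" using y unfolding S_def by simp
  have "(G u * a) mod d = (t * a) mod d"
    using return_map[OF uS] y(2) u by simp
  then have "t mod n = G u mod n" using mult_a_cong_iff by simp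
  \<comment> \<open>The lift hits \<open>t\<close> only modulo \<open>n\<close>; translating
    \<open>u\<close> by whole periods corrects this.\<close>
  then obtain k where "t = G u + n * k"
    by (metis dvdE mod_eq_dvd_iff diff_eq_eq add.commute)
  then have "G (u + n * k) = t" using G_periodic by simp
  moreover have "u + n * k \<in> S"
    using uS periodic_set_mult S_periodic by blast
  ultimately show ?thesis using that by blast
qed

section \<open>Coordinates on \<open>N\<close> and conjugation to the skew shift\<close>

lemma row_representative:
  assumes x: "x \<in> N"
  obtains j u where "j < nat g" "u \<in> S \<inter> {0..<n}" "x = (q ^^ j) ((u * a) mod d)"
proof -
  \<comment> \<open>With \<open>s\<close> inverse to \<open>c\<close> modulo \<open>g\<close>,
    \<open>j\<close> is the number of steps from the subgroup to the coset of \<open>x\<close>.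
    Pulling \<open>x\<close> back by \<open>j\<close> iterates then lands in the subgroup.\<close>
  obtain s where s: "[c * s = 1] (mod g)"
    using cong_solve_coprime_int coprime_g_c by (metis coprime_commute)
  define j where "j = nat ((s * x) mod g)"
  have j: "j \<in> {0..<nat g}" "int j = (s * x) mod g"
    using g_pos unfolding j_def by (auto simp: nat_less_iff)
  have "[int j * c = (s * x) * c] (mod g)"
    using j(2) by (simp add: cong_def mod_mult_left_eq)
  also have "[(s * x) * c = x] (mod g)"
    using cong_scalar_right[OF s, of x] by (simp add: mult.commute mult.left_commute)
  finally have jc: "g dvd int j * c - x" by (simp add: cong_iff_dvd_diff)
  obtain y where y: "y \<in> N" "x = (q ^^ j) y"
    using x permutes_image[OF funpow_permutes[of j]] by (metis imageE)
  have "g dvd (x - y - int j * c) + (int j * c - x)"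
    using funpow_mod_g[OF y(1), of j] y(2) jc by (intro dvd_add) auto
  then have "g dvd y" by simp
  moreover have "y \<in> {0..<d}" using y N_sub by auto
  ultimately obtain u where u: "u \<in> {0..<n}" "y = (u * a) mod d"
    using multiple_of_g by metis
  then have "u \<in> S \<inter> {0..<n}" using y unfolding S_def by simp
  with j y u that show ?thesis by auto
qed

text \<open>The residue modulo \<open>g\<close> determines \<open>j\<close>, since \<open>c\<close>
  is invertible there; injectivity of the iterate and the order \<open>n\<close> of \<open>a\<close>
  then determine \<open>l\<close>.\<close>

lemma row_decomposition:
  assumes e: "bij_betw e {0..<m} (S \<inter> {0..<n})"
  shows "bij_betw (\<lambda>(j, l). (q ^^ j) ((e l * a) mod d)) ({0..<nat g} \<times> {0..<m}) N"
    (is "bij_betw ?E ?K N")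
proof (rule bij_betw_imageI)
  have eS: "e l \<in> S" "e l \<in> {0..<n}" if "l \<in> {0..<m}" for l
    using that e bij_betwE by blast+
  have base: "(e l * a) mod d \<in> N" "g dvd (e l * a) mod d" if "l \<in> {0..<m}" for l
    using eS[OF that] unfolding S_def by (auto simp: dvd_mod)
  show "inj_on ?E ?K"
  proof (rule inj_onI, clarify)
    fix j l j' l'
    assume j: "j \<in> {0..<nat g}" "j' \<in> {0..<nat g}" and l: "l \<in> {0..<m}" "l' \<in> {0..<m}"
      and eq: "(q ^^ j) ((e l * a) mod d) = (q ^^ j') ((e l' * a) mod d)"
    have row: "g dvd (q ^^ i) ((e k * a) mod d) - int i * c" if "k \<in> {0..<m}" for i k
    proof -
      have "g dvd ((q ^^ i) ((e k * a) mod d) - (e k * a) mod d - int i * c) + (e k * a) mod d"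
        by (intro dvd_add funpow_mod_g base that)
      then show ?thesis by simp
    qed
    have "g dvd ((q ^^ j) ((e l * a) mod d) - int j * c)
        - ((q ^^ j') ((e l' * a) mod d) - int j' * c)"
      by (rule dvd_diff[OF row[OF l(1)] row[OF l(2)]])
    then have "g dvd (int j' - int j) * c" using eq by (simp add: algebra_simps)
    then have "g dvd int j' - int j"
      using coprime_g_c by (simp add: coprime_dvd_mult_left_iff)
    then have "int j' mod g = int j mod g" by (simp add: mod_eq_dvd_iff)
    moreover have "int j' mod g = int j'" "int j mod g = int j" using j by auto
    ultimately have jj: "j = j'" by simp
    with eq have "(e l * a) mod d = (e l' * a) mod d" using funpow_inj by simp
    then have "e l mod n = e l' mod n" using mult_a_cong_iff by simp
    then have "e l = e l'" using eS l by simp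
    then have "l = l'" using e l unfolding bij_betw_def inj_on_def by blast
    with jj show "j = j' \<and> l = l'" by simp
  qed
  show "?E ` ?K = N"
  proof (intro equalityI subsetI)
    fix x assume "x \<in> ?E ` ?K"
    then show "x \<in> N" using funpow_in base by auto
  next
    fix x assume x: "x \<in> N"
    obtain j u where ju: "j < nat g" "u \<in> S \<inter> {0..<n}" "x = (q ^^ j) ((u * a) mod d)"
      using row_representative[OF x] .
    then obtain l where "l \<in> {0..<m}" "e l = u"
      using e unfolding bij_betw_def by (metis imageE)
    with ju show "x \<in> ?E ` ?K" by (auto intro!: image_eqI[of _ _ "(j, l)"])
  qed
qed

text \<open>On \<open>S\<close> the lift \<open>G\<close> is an increasing bijection, so on indices
  it is an order automorphism of the integers, hence a translation.\<close>

lemma return_map_enumerated: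
  fixes e :: "int \<Rightarrow> int"
  assumes e: "strict_mono e" "range e = S"
  obtains W where "\<And>l. G (e l) = e (l + W)"
proof -
  have "\<forall>l. \<exists>k. G (e l) = e k"
    using G_in_S e(2) by (metis rangeE rangeI)
  then obtain s where s: "\<And>l. G (e l) = e (s l)" by metis
  have "strict_mono s"
  proof (rule strict_monoI)
    fix l l' :: int assume "l < l'"
    then have "G (e l) < G (e l')"
      using G_mono e by (metis rangeI strict_mono_less)
    then show "s l < s l'" using s e(1) by (simp add: strict_mono_less)
  qed
  moreover have "surj s"
    unfolding surj_def
  proof
    fix k
    obtain u where "u \<in> S" "G u = e k" using G_surj e(2) by (metis rangeI)
    then obtain l where "G (e l) = e k" using e(2) by (metis rangeE)
    then have "s l = k" using s e(1) by (metis strict_mono_eq)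
    then show "\<exists>l. k = s l" by blast
  qed
  ultimately have lin: "s l = s 0 + l" for l using strict_mono_surj_int by blast
  show ?thesis
    by (rule that[of "s 0"]) (metis s lin add.commute)
qed

text \<open>In row coordinates \<open>q\<close> passes to the next coset keeping \<open>l\<close>;
  from the last coset it completes a return, which rotates the index by \<open>W\<close>. Counting
  the total displacement of \<open>G\<close> over one period in two ways gives the formula for
  \<open>W\<close>.\<close>

theorem conj_skew_shift:
  assumes "N \<noteq> {}"
  defines "m \<equiv> int (card N) div g"
  defines "W \<equiv> (m * rho + (\<Sum>x\<in>N. \<delta> x)) div n"
  defines "K \<equiv> {0..<nat g} \<times> {0..<m}"
  shows "\<exists>E. bij_betw E K N \<and> (\<forall>z\<in>K. skew_shift (nat g) m W z \<in> K
    \<and> q (E z) = E (skew_shift (nat g) m W z))"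
proof -
  obtain x where "x \<in> N" using assms(1) by auto
  then have "S \<noteq> {}" using row_representative[of x] by blast
  then obtain e m' where e: "strict_mono e" "range e = S" "m' > 0"
      "\<And>l k. e (l + m' * k) = e l + n * k" "bij_betw e {0..<m'} (S \<inter> {0..<n})"
    using periodic_enumeration[OF n_pos S_periodic] by metis
  define E where "E = (\<lambda>(j, l). (q ^^ j) ((e l * a) mod d))"
  have bij: "bij_betw E ({0..<nat g} \<times> {0..<m'}) N"
    unfolding E_def by (rule row_decomposition[OF e(5)])
  have "card N = nat g * nat m'"
    using bij_betw_same_card[OF bij] by simp
  then have "int (card N) = g * m'"
    using g_pos e(3) by (simp add: of_nat_mult)
  then have m: "m' = m"
    unfolding m_def using g_pos by simp
  note e = e[unfolded m] and bij = bij[unfolded m]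
  obtain W' where W': "\<And>l. G (e l) = e (l + W')"
    using return_map_enumerated[OF e(1,2)] by blast
  have "(\<Sum>l\<in>{0..<m}. G (e l)) = (\<Sum>l\<in>{0..<m}. e l) + n * W'"
    unfolding W' by (rule sum_shift_quasiperiodic) (use e(3) e(4)[of _ 1] in auto)
  moreover have "(\<Sum>l\<in>{0..<m}. G (e l))
      = (\<Sum>l\<in>{0..<m}. e l) + m * rho + (\<Sum>l\<in>{0..<m}. D (nat g) ((e l * a) mod d))"
    unfolding G_def using e(3) by (simp add: sum.distrib)
  \<comment> \<open>The first \<open>g\<close> iterates of the base points run through
    \<open>N\<close> exactly once, so their drifts add up to the sum over \<open>N\<close>.\<close>
  moreover have "(\<Sum>l\<in>{0..<m}. D (nat g) ((e l * a) mod d)) = (\<Sum>x\<in>N. \<delta> x)"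
  proof -
    have "(\<Sum>x\<in>N. \<delta> x) = (\<Sum>z\<in>{0..<nat g} \<times> {0..<m}. \<delta> (E z))"
      by (rule sum.reindex_bij_betw[OF bij, symmetric])
    also have "\<dots> = (\<Sum>j\<in>{0..<nat g}. \<Sum>l\<in>{0..<m}. \<delta> ((q ^^ j) ((e l * a) mod d)))"
      unfolding E_def by (simp add: sum.cartesian_product case_prod_unfold)
    also have "\<dots> = (\<Sum>l\<in>{0..<m}. D (nat g) ((e l * a) mod d))"
      unfolding D_def lessThan_atLeast0 by (rule sum.swap)
    finally show ?thesis by simp
  qed
  ultimately have "m * rho + (\<Sum>x\<in>N. \<delta> x) = n * W'" by simp
  then have W: "W' = W" unfolding W_def using n_pos by simp
  have "skew_shift (nat g) m W z \<in> K \<and> q (E z) = E (skew_shift (nat g) m W z)"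
    if zK: "z \<in> K" for z
  proof -
    obtain j l where z: "z = (j, l)" "j < nat g" "l \<in> {0..<m}"
      using zK unfolding K_def by auto
    show ?thesis
    proof (cases "Suc j < nat g")
      case True
      then show ?thesis using z unfolding skew_shift_def K_def E_def by auto
    next
      case False
      then have j: "Suc j = nat g" using z by simp
      define l' where "l' = (l + W) mod m"
      have l': "l + W = l' + m * ((l + W) div m)" unfolding l'_def by simp
      have "e l \<in> S" using e(2) by auto
      have "q (E z) = (q ^^ nat g) ((e l * a) mod d)"
        unfolding z E_def j[symmetric] by simp
      also have "\<dots> = (e (l + W) * a) mod d"
        using return_map[OF \<open>e l \<in> S\<close>] W' W by simp
      \<comment> \<open>Reducing the index modulo \<open>m\<close> changes \<open>e\<close> by a
        multiple of \<open>n\<close>, which \<open>a\<close> annihilates modulo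
        \<open>d\<close>.\<close>
      also have "\<dots> = (e l' * a) mod d"
        by (subst mult_a_cong_iff, subst l', subst e(4)) simp
      also have "\<dots> = E (0, l')" unfolding E_def by simp
      finally show ?thesis
        using j z e(3) g_pos unfolding skew_shift_def K_def l'_def by auto
    qed
  qed
  with bij show ?thesis unfolding K_def by blast
qed

end

section \<open>Signs of conjugate permutations\<close>

lemma sign_eq_of_conj:
  assumes f: "bij_betw f A B" and "finite A" and p: "p permutes A" and q: "q permutes B"
    and comm: "\<And>x. x \<in> A \<Longrightarrow> f (p x) = q (f x)"
  shows "sign p = sign q"
proof -
  have inj: "inj_on f A" and im: "f ` A = B"
    using f by (auto simp: bij_betw_def)
  \<comment> \<open>Transport along a bijection preserves the sign, so it suffices to recognise
    \<open>q\<close> as the transport of \<open>p\<close>; off \<open>B\<close> both are the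
    identity.\<close>
  have "map_permutation A f p = q"
  proof
    fix y
    show "map_permutation A f p y = q y"
    proof (cases "y \<in> B")
      case True
      then obtain x where "x \<in> A" "y = f x" using im by auto
      then show ?thesis using map_permutation_apply[OF inj] comm by simp
    next
      case False
      then show ?thesis
        using map_permutation_permutes[OF f p] q by (metis permutes_not_in)
    qed
  qed
  with sign_map_permutation[OF inj p \<open>finite A\<close>] show ?thesis by metis
qed

text \<open>Equal counts give the same skew shift for both. Composing the two coordinate systems
  conjugates \<open>q\<close> to \<open>q'\<close> directly, so the sign of the model never has to
  be computed.\<close>

lemma sign_drifting_permutation_unique:
  assumes q: "drifting_permutation d a c N q \<delta>" and q': "drifting_permutation d a c N' q' \<delta>'"
    and card: "card N = card N'" and sum: "(\<Sum>x\<in>N. \<delta> x) = (\<Sum>x\<in>N'. \<delta>' x)"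
  shows "sign q = sign q'"
proof (cases "N = {}")
  case True
  then have "N' = {}"
    using card drifting_permutation.finite_N[OF q'] by simp
  with True have "q = id" "q' = id"
    using drifting_permutation.q_permutes[OF q] drifting_permutation.q_permutes[OF q'] by auto
  then show ?thesis by simp
next
  case False
  then have False': "N' \<noteq> {}"
    using card drifting_permutation.finite_N[OF q] by auto
  obtain g m W where "\<exists>E. bij_betw E ({0..<g} \<times> {0..<m}) N
      \<and> (\<forall>z\<in>{0..<g} \<times> {0..<m}. skew_shift g m W z \<in> {0..<g} \<times> {0..<m}
        \<and> q (E z) = E (skew_shift g m W z))"
    and "\<exists>E. bij_betw E ({0..<g} \<times> {0..<m}) N'
      \<and> (\<forall>z\<in>{0..<g} \<times> {0..<m}. skew_shift g m W z \<in> {0..<g} \<times> {0..<m}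
        \<and> q' (E z) = E (skew_shift g m W z))"
    using drifting_permutation.conj_skew_shift[OF q False]
      drifting_permutation.conj_skew_shift[OF q' False'] unfolding card sum by (rule that)
  then obtain E E' K where E: "bij_betw E K N" and E': "bij_betw E' K N'"
    and K: "\<And>z. z \<in> K \<Longrightarrow> skew_shift g m W z \<in> K"
    and comm: "\<And>z. z \<in> K \<Longrightarrow> q (E z) = E (skew_shift g m W z)"
      "\<And>z. z \<in> K \<Longrightarrow> q' (E' z) = E' (skew_shift g m W z)"
    by blast
  have inv: "inv_into K E (E z) = z" if "z \<in> K" for z
    using E that by (simp add: bij_betw_def)
  show ?thesis
  proof (rule sign_eq_of_conj)
    show "bij_betw (E' \<circ> inv_into K E) N N'"
      using bij_betw_inv_into[OF E] E' by (rule bij_betw_trans)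
    show "finite N" by (rule drifting_permutation.finite_N[OF q])
    show "q permutes N" "q' permutes N'"
      using q q' by (auto dest: drifting_permutation.q_permutes)
    fix x assume "x \<in> N"
    then obtain z where "z \<in> K" "x = E z" using E by (auto simp: bij_betw_def)
    then show "(E' \<circ> inv_into K E) (q x) = q' ((E' \<circ> inv_into K E) x)"
      using comm K inv by simp
  qed
qed

section \<open>Three-step permutations as drifting permutations\<close>

lemma rotation_permutes: "(\<lambda>x. if x < d then (x + k) mod d else x) permutes {0..<d::nat}"
proof (rule bij_imp_permutes)
  let ?r = "\<lambda>x. if x < d then (x + k) mod d else x"
  have inj: "inj_on ?r {0..<d}"
  proof (rule inj_onI)
    fix x y assume xy: "x \<in> {0..<d}" "y \<in> {0..<d}" "?r x = ?r y"
    then have "[x + k = y + k] (mod d)" by (simp add: cong_def)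
    then have "[x = y] (mod d)" by (simp add: cong_add_rcancel_nat)
    with xy show "x = y" by (simp add: cong_def)
  qed
  have "?r ` {0..<d} \<subseteq> {0..<d}" by auto
  then show "bij_betw ?r {0..<d} {0..<d}"
    by (rule bij_betw_imageI[OF inj endo_inj_surj[OF finite_atLeastLessThan _ inj]])
qed auto

lemma add_mod_eq_iff:
  fixes i :: nat
  assumes "s < d" "t < d"
  shows "(i + s) mod d = (i + t) mod d \<longleftrightarrow> s = t"
proof -
  have "(i + s) mod d = (i + t) mod d \<longleftrightarrow> [s = t] (mod d)"
    unfolding cong_def[symmetric] by (rule cong_add_lcancel_nat)
  then show ?thesis using assms by (simp add: cong_def)
qed

text \<open>Rotating by \<open>d - b\<close> after \<open>p\<close> turns the \<open>b\<close>-steps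
  into fixed points and the other steps into \<open>-b\<close> or \<open>-b + a\<close>. The sign
  changes by a factor independent of \<open>p\<close>.\<close>

lemma three_step_drifting:
  fixes d a b :: nat
  assumes ab: "0 < a" "a < b" "b < d" and gcd: "gcd a (gcd b d) = 1"
    and p: "p permutes {0..<d}"
    and steps: "\<And>i. i < d \<Longrightarrow> p i = i \<or> p i = (i + a) mod d \<or> p i = (i + b) mod d"
  defines "r \<equiv> \<lambda>x. if x < d then (x + (d - b)) mod d else x"
  obtains N q \<delta> where "drifting_permutation (int d) (int a) (int d - int b) N q \<delta>"
    "sign q = sign r * sign p"
    "card N = d - card {i\<in>{0..<d}. p i = (i + b) mod d}"
    "(\<Sum>x\<in>N. \<delta> x) = int (card {i\<in>{0..<d}. p i = (i + a) mod d})"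
proof -
  define M where "M = {i\<in>{0..<d}. p i \<noteq> (i + b) mod d}"
  have r: "r permutes {0..<d}" unfolding r_def by (rule rotation_permutes)
  have in_range: "p i < d" if "i < d" for i
    using permutes_in_image[OF p, of i] that by simp
  have rp_M: "(r \<circ> p) permutes M"
  proof (rule permutes_superset)
    show "(r \<circ> p) permutes {0..<d}" using p r by (rule permutes_compose)
    fix i assume "i \<in> {0..<d} - M"
    then have i: "i < d" "p i = (i + b) mod d" unfolding M_def by auto
    then have "(r \<circ> p) i = ((i + b) mod d + (d - b)) mod d"
      using in_range unfolding r_def by simp
    also have "\<dots> = (i + b + (d - b)) mod d" by (rule mod_add_left_eq)
    also have "\<dots> = i" using ab i(1) by simp
    finally show "(r \<circ> p) i = i" .
  qed
  define q where "q = map_permutation M int (r \<circ> p)"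
  define \<delta> where "\<delta> x = (if p (nat x) = (nat x + a) mod d then 1 else 0 :: int)" for x
  have inj: "inj_on int M" by simp
  have finM: "finite M" unfolding M_def by simp
  show ?thesis
  proof (rule that[of "int ` M" q \<delta>])
    show "drifting_permutation (int d) (int a) (int d - int b) (int ` M) q \<delta>"
    proof
      show "0 < int d" using ab by simp
      have "int 1 = gcd (int a) (gcd (int b) (int d))"
        unfolding gcd[symmetric] by simp
      also have "gcd (int b) (int d) = gcd (int d - int b) (int d)"
        by (metis gcd.commute gcd_diff2)
      finally show "gcd (int a) (gcd (int d - int b) (int d)) = 1" by simp
      show "int ` M \<subseteq> {0..<int d}" unfolding M_def by auto
      show "q permutes int ` M"
        unfolding q_def by (rule map_permutation_permutes[OF _ rp_M]) (simp add: bij_betw_def)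
      show "\<delta> x = 0 \<or> \<delta> x = 1" for x unfolding \<delta>_def by simp
      fix x assume "x \<in> int ` M"
      then obtain i where i: "i \<in> M" "x = int i" by auto
      then have id: "i < d" and nb: "p i \<noteq> (i + b) mod d" unfolding M_def by auto
      have na: "(i + a) mod d \<noteq> i"
        using add_mod_eq_iff[of a d 0 i] ab id by simp
      have "q x = int ((p i + (d - b)) mod d)"
        unfolding q_def i(2) map_permutation_apply[OF inj i(1)]
        using in_range[OF id] by (simp add: r_def)
      also have "\<dots> = (int (p i) + (int d - int b)) mod int d"
        using ab by (simp add: zmod_int of_nat_diff add_diff_eq)
      also have "int (p i) = (x + \<delta> x * int a) mod int d"
        using steps[OF id] nb na id unfolding \<delta>_def i(2) by (auto simp: zmod_int)
      also have "((x + \<delta> x * int a) mod int d + (int d - int b)) mod int d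
          = (x + (int d - int b) + \<delta> x * int a) mod int d"
        unfolding mod_add_left_eq by (simp only: ac_simps)
      finally show "q x = (x + (int d - int b) + \<delta> x * int a) mod int d" .
    qed
    have "permutation r" "permutation p"
      using p r by (auto intro: permutes_imp_permutation[of "{0..<d}"])
    then have "sign (r \<circ> p) = sign r * sign p" by (rule sign_compose)
    then show "sign q = sign r * sign p"
      unfolding q_def sign_map_permutation[OF inj rp_M finM] .
    have "M = {0..<d} - {i\<in>{0..<d}. p i = (i + b) mod d}" unfolding M_def by auto
    moreover have sub: "{i\<in>{0..<d}. p i = (i + b) mod d} \<subseteq> {0..<d}" by auto
    ultimately have "card M = d - card {i\<in>{0..<d}. p i = (i + b) mod d}"
      using card_Diff_subset[OF finite_subset[OF sub finite_atLeastLessThan] sub] by simp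
    then show "card (int ` M) = d - card {i\<in>{0..<d}. p i = (i + b) mod d}"
      by (simp add: card_image)
    have "(\<Sum>x\<in>int ` M. \<delta> x) = (\<Sum>i\<in>M. if p i = (i + a) mod d then 1 else 0)"
      by (simp add: sum.reindex \<delta>_def)
    also have "\<dots> = int (card {i\<in>M. p i = (i + a) mod d})"
      using finM by (simp add: sum.If_cases Int_def)
    \<comment> \<open>Steps by \<open>a\<close> and by \<open>b\<close> lead to different points, so
      no \<open>a\<close>-step is lost outside \<open>M\<close>.\<close>
    also have "{i\<in>M. p i = (i + a) mod d} = {i\<in>{0..<d}. p i = (i + a) mod d}"
      using add_mod_eq_iff[of b d a] ab unfolding M_def by auto
    finally show "(\<Sum>x\<in>int ` M. \<delta> x) = int (card {i\<in>{0..<d}. p i = (i + a) mod d})" .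
  qed
qed

theorem sign_three_step_permutation_unique:
  fixes d a b :: nat
  assumes ab: "0 < a" "a < b" "b < d" and gcd: "gcd a (gcd b d) = 1"
    and p: "p permutes {0..<d}"
      "\<And>i. i < d \<Longrightarrow> p i = i \<or> p i = (i + a) mod d \<or> p i = (i + b) mod d"
    and p': "p' permutes {0..<d}"
      "\<And>i. i < d \<Longrightarrow> p' i = i \<or> p' i = (i + a) mod d \<or> p' i = (i + b) mod d"
    and card_a: "card {i\<in>{0..<d}. p i = (i + a) mod d} = card {i\<in>{0..<d}. p' i = (i + a) mod d}"
    and card_b: "card {i\<in>{0..<d}. p i = (i + b) mod d} = card {i\<in>{0..<d}. p' i = (i + b) mod d}"
  shows "sign p = sign p'"
proof -
  obtain N q \<delta> where 1: "drifting_permutation (int d) (int a) (int d - int b) N q \<delta>"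
    "sign q = sign (\<lambda>x. if x < d then (x + (d - b)) mod d else x) * sign p"
    "card N = d - card {i\<in>{0..<d}. p i = (i + b) mod d}"
    "(\<Sum>x\<in>N. \<delta> x) = int (card {i\<in>{0..<d}. p i = (i + a) mod d})"
    using three_step_drifting[OF ab gcd p] .
  obtain N' q' \<delta>' where 2: "drifting_permutation (int d) (int a) (int d - int b) N' q' \<delta>'"
    "sign q' = sign (\<lambda>x. if x < d then (x + (d - b)) mod d else x) * sign p'"
    "card N' = d - card {i\<in>{0..<d}. p' i = (i + b) mod d}"
    "(\<Sum>x\<in>N'. \<delta>' x) = int (card {i\<in>{0..<d}. p' i = (i + a) mod d})"
    using three_step_drifting[OF ab gcd p'] .
  have "sign q = sign q'"
    by (rule sign_drifting_permutation_unique[OF 1(1) 2(1)])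
      (simp_all only: 1(3,4) 2(3,4) card_a card_b)
  \<comment> \<open>The sign of the rotation is the same nonzero factor on both sides and
    cancels.\<close>
  then show ?thesis using 1(2) 2(2) by simp
qed

section \<open>Coefficients of the determinant and the permanent\<close>

definition three_step :: "nat \<Rightarrow> nat \<Rightarrow> nat \<Rightarrow> (nat \<Rightarrow> nat) \<Rightarrow> bool" where
  "three_step d a b p \<longleftrightarrow> (\<forall>i\<in>{0..<d}. p i = i \<or> p i = (i + a) mod d \<or> p i = (i + b) mod d)"

text \<open>\<open>Z\<close> is also the default where the matrix entry is zero;
  \<open>three_step\<close> excludes such positions.\<close>

definition step_var :: "nat \<Rightarrow> nat \<Rightarrow> nat \<Rightarrow> nat \<Rightarrow> indet" where
  "step_var d a i j = (if j = i then X else if j = (i + a) mod d then Y else Z)"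

definition step_monomial :: "nat \<Rightarrow> nat \<Rightarrow> (nat \<Rightarrow> nat) \<Rightarrow> (indet \<Rightarrow>\<^sub>0 nat)" where
  "step_monomial d a p = (\<Sum>i\<in>{0..<d}. Poly_Mapping.single (step_var d a i (p i)) 1)"

lemma cong_step_iff:
  assumes "i < d" "j < d" "s < d"
  shows "[int j - int i = int s] (mod int d) \<longleftrightarrow> j = (i + s) mod d"
proof -
  have "[int j - int i = int s] (mod int d) \<longleftrightarrow> [int j = int (i + s)] (mod int d)"
    by (simp add: cong_iff_dvd_diff algebra_simps)
  also have "\<dots> \<longleftrightarrow> [j = i + s] (mod d)" by (rule cong_int_iff)
  finally show ?thesis using assms by (simp add: cong_def)
qed

lemma circ_entry:
  assumes "i < d" "j < d" "a < d" "b < d"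
  shows "circ d a b $$ (i, j) = (if j = i \<or> j = (i + a) mod d \<or> j = (i + b) mod d
    then Poly_Mapping.single (Poly_Mapping.single (step_var d a i j) 1) 1 else 0)"
  using assms cong_step_iff[of i d j a] cong_step_iff[of i d j b] cong_step_iff[of i d j 0]
  by (auto simp: circ_def var_def step_var_def)

lemma prod_single_one:
  "(\<Prod>i\<in>I. if P i then Poly_Mapping.single (f i) 1 else 0) =
    (if \<forall>i\<in>I. P i then Poly_Mapping.single (\<Sum>i\<in>I. f i) 1 else (0 :: poly_xyz))"
  if "finite I" for f :: "'i \<Rightarrow> indet \<Rightarrow>\<^sub>0 nat"
  using that by (induction I rule: finite_induct) (auto simp: mult_single)

lemma prod_circ:
  assumes "a < d" "b < d" "p permutes {0..<d}"
  shows "(\<Prod>i = 0..<d. circ d a b $$ (i, p i)) =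
    (if three_step d a b p then Poly_Mapping.single (step_monomial d a p) 1 else 0)"
proof -
  have "(\<Prod>i = 0..<d. circ d a b $$ (i, p i)) =
    (\<Prod>i\<in>{0..<d}. if p i = i \<or> p i = (i + a) mod d \<or> p i = (i + b) mod d
      then Poly_Mapping.single (Poly_Mapping.single (step_var d a i (p i)) 1) 1 else 0)"
    using assms permutes_in_image[OF assms(3)]
    by (intro prod.cong refl circ_entry) auto
  then show ?thesis
    unfolding three_step_def step_monomial_def by (simp only: prod_single_one finite_atLeastLessThan)
qed

lemma circ_carrier: "circ d a b \<in> carrier_mat d d"
  by (simp add: circ_def)

definition step_perms :: "nat \<Rightarrow> nat \<Rightarrow> nat \<Rightarrow> (indet \<Rightarrow>\<^sub>0 nat) \<Rightarrow> (nat \<Rightarrow> nat) set" where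
  "step_perms d a b \<mu> = {p. p permutes {0..<d} \<and> three_step d a b p \<and> step_monomial d a p = \<mu>}"

text \<open>By \<open>prod_circ\<close> each Leibniz term is zero or a single monomial with
  coefficient \<open>sign p\<close>, so only the permutations in \<open>step_perms\<close>
  contribute.\<close>

lemma lookup_det_circ:
  assumes "a < d" "b < d"
  shows "Poly_Mapping.lookup (det (circ d a b)) \<mu> = (\<Sum>p\<in>step_perms d a b \<mu>. sign p)"
proof -
  let ?P = "{p. p permutes {0..<d}}"
  have fin: "finite ?P" by (simp add: finite_permutations)
  have "Poly_Mapping.lookup (of_int (sign p) * (\<Prod>i = 0..<d. circ d a b $$ (i, p i))) \<mu>
      = (if p \<in> step_perms d a b \<mu> then sign p else 0)" if "p \<in> ?P" for p
    using that assms
    by (cases p rule: sign_cases) (auto simp: prod_circ step_perms_def lookup_single when_def)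
  then have "Poly_Mapping.lookup (det (circ d a b)) \<mu>
      = (\<Sum>p\<in>?P. if p \<in> step_perms d a b \<mu> then sign p else 0)"
    by (simp add: det_def'[OF circ_carrier] lookup_sum)
  also have "\<dots> = (\<Sum>p\<in>step_perms d a b \<mu>. sign p)"
    using fin by (intro sum.mono_neutral_cong_right) (auto simp: step_perms_def)
  finally show ?thesis .
qed

lemma lookup_permanent_circ:
  assumes "a < d" "b < d"
  shows "Poly_Mapping.lookup (permanent (circ d a b)) \<mu> = int (card (step_perms d a b \<mu>))"
proof -
  let ?P = "{p. p permutes {0..<d}}"
  have fin: "finite ?P" by (simp add: finite_permutations)
  have "Poly_Mapping.lookup (\<Prod>i = 0..<d. circ d a b $$ (i, p i)) \<mu>
      = (if p \<in> step_perms d a b \<mu> then 1 else 0)" if "p \<in> ?P" for p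
    using that assms by (auto simp: prod_circ step_perms_def lookup_single when_def)
  then have "Poly_Mapping.lookup (permanent (circ d a b)) \<mu>
      = (\<Sum>p\<in>?P. if p \<in> step_perms d a b \<mu> then 1 else 0)"
    using circ_carrier[of d a b] by (simp add: permanent_def lookup_sum)
  also have "\<dots> = (\<Sum>p\<in>step_perms d a b \<mu>. 1)"
    using fin by (intro sum.mono_neutral_cong_right) (auto simp: step_perms_def)
  finally show ?thesis by simp
qed

lemma lookup_step_monomial:
  "Poly_Mapping.lookup (step_monomial d a p) v = card {i\<in>{0..<d}. step_var d a i (p i) = v}"
  by (simp add: step_monomial_def lookup_sum lookup_single when_def sum.If_cases Int_def)

text \<open>As \<open>0\<close>, \<open>a\<close>, \<open>b\<close> are distinct modulo
  \<open>d\<close>, the exponents of \<open>Y\<close> and \<open>Z\<close> count the steps by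
  \<open>a\<close> and by \<open>b\<close>, and these counts fix the sign.\<close>

lemma sign_step_perms_unique:
  assumes ab: "0 < a" "a < b" "b < d" and gcd: "gcd a (gcd b d) = 1"
    and p: "p \<in> step_perms d a b \<mu>" and p': "p' \<in> step_perms d a b \<mu>"
  shows "sign p = sign p'"
proof -
  have card: "card {i\<in>{0..<d}. q i = (i + a) mod d} = Poly_Mapping.lookup \<mu> Y"
    "card {i\<in>{0..<d}. q i = (i + b) mod d} = Poly_Mapping.lookup \<mu> Z"
    if q: "q \<in> step_perms d a b \<mu>" for q
  proof -
    have "q i = (i + a) mod d \<longleftrightarrow> step_var d a i (q i) = Y"
      "q i = (i + b) mod d \<longleftrightarrow> step_var d a i (q i) = Z" if i: "i < d" for i
    proof -
      have "(i + a) mod d \<noteq> i" "(i + b) mod d \<noteq> i" "(i + a) mod d \<noteq> (i + b) mod d"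
        using add_mod_eq_iff[of a d 0 i] add_mod_eq_iff[of b d 0 i] add_mod_eq_iff[of a d b i] ab i
        by auto
      moreover have "q i = i \<or> q i = (i + a) mod d \<or> q i = (i + b) mod d"
        using q i unfolding step_perms_def three_step_def by auto
      ultimately show "q i = (i + a) mod d \<longleftrightarrow> step_var d a i (q i) = Y"
        "q i = (i + b) mod d \<longleftrightarrow> step_var d a i (q i) = Z"
        unfolding step_var_def by (auto split: if_splits)
    qed
    then have "{i\<in>{0..<d}. q i = (i + a) mod d} = {i\<in>{0..<d}. step_var d a i (q i) = Y}"
      "{i\<in>{0..<d}. q i = (i + b) mod d} = {i\<in>{0..<d}. step_var d a i (q i) = Z}"
      by auto
    then show "card {i\<in>{0..<d}. q i = (i + a) mod d} = Poly_Mapping.lookup \<mu> Y"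
      "card {i\<in>{0..<d}. q i = (i + b) mod d} = Poly_Mapping.lookup \<mu> Z"
      using q lookup_step_monomial[of d a q] unfolding step_perms_def by auto
  qed
  show ?thesis
    by (rule sign_three_step_permutation_unique[OF ab gcd])
      (use p p' card[OF p] card[OF p'] in \<open>auto simp: step_perms_def three_step_def\<close>)
qed

text \<open>All contributing permutations share one sign, so nothing cancels and that sign factors
  out of the sum.\<close>

lemma lookup_det_eq_pm_permanent:
  assumes ab: "0 < a" "a < b" "b < d" and gcd: "gcd a (gcd b d) = 1"
  shows "Poly_Mapping.lookup (det (circ d a b)) \<mu> = Poly_Mapping.lookup (permanent (circ d a b)) \<mu>
    \<or> Poly_Mapping.lookup (det (circ d a b)) \<mu> = - Poly_Mapping.lookup (permanent (circ d a b)) \<mu>"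
proof (cases "step_perms d a b \<mu> = {}")
  case True
  then show ?thesis using ab by (simp add: lookup_det_circ lookup_permanent_circ)
next
  case False
  then obtain p where p: "p \<in> step_perms d a b \<mu>" by auto
  have "Poly_Mapping.lookup (det (circ d a b)) \<mu> = (\<Sum>p'\<in>step_perms d a b \<mu>. sign p)"
    using ab sign_step_perms_unique[OF ab gcd _ p] by (simp add: lookup_det_circ)
  also have "\<dots> = sign p * Poly_Mapping.lookup (permanent (circ d a b)) \<mu>"
    using ab by (simp add: lookup_permanent_circ)
  finally show ?thesis by (cases p rule: sign_cases) auto
qed

theorem theorem2p3:
  fixes d a b :: nat
  assumes "d \<ge> 3"
    and "1 \<le> a" and "a < b" and "b \<le> d - 1"
    and "gcd a (gcd b d) = 1"
  shows "(\<forall>A B. A + B \<le> d \<longrightarrow>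
            coeff_xyz (det (circ d a b)) (d - A - B) A B
              = coeff_xyz (permanent (circ d a b)) (d - A - B) A B
          \<or> coeff_xyz (det (circ d a b)) (d - A - B) A B
              = - coeff_xyz (permanent (circ d a b)) (d - A - B) A B)
    \<and> num_monomials (det (circ d a b)) = num_monomials (permanent (circ d a b))"
proof -
  have "0 < a" "b < d" using assms by auto
  note pm = lookup_det_eq_pm_permanent[OF this(1) \<open>a < b\<close> this(2) assms(5)]
  \<comment> \<open>Coefficients equal up to sign vanish together, so both polynomials have the same
    support.\<close>
  have "\<mu> \<in> Poly_Mapping.keys (det (circ d a b))
      \<longleftrightarrow> \<mu> \<in> Poly_Mapping.keys (permanent (circ d a b))" for \<mu>
    using pm[of \<mu>] by (auto simp: in_keys_iff)
  then have "Poly_Mapping.keys (det (circ d a b)) = Poly_Mapping.keys (permanent (circ d a b))"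
    by blast
  then show ?thesis using pm unfolding coeff_xyz_def num_monomials_def by simp
qed

end
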